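(* Let $D$ be a commutative ring and let $R \subseteq D$ be a subring with $\mathsf T(R)=\mathsf T(D)$ such that $$D = RD^{\times}, \qquad D^{\times}\cap R = R^{\times}, \qquad\text{and}\qquad (R:D) \in v\text{-}\max(R).$$ Then the inclusion $R^{\bullet}\hookrightarrow D^{\bullet}$ is a transfer homomorphism. In particular, if $R$ is atomic, then $\mathcal L(R)=\mathcal L(D)$.
   Context: Rings are non-zero, commutative, with unit element. For a ring $R$: $\mathsf T(R)$ is its total quotient ring, $R^\times$ its unit group, $\mathsf Z(R)$ its set of zero-divisors (with $0\in \mathsf Z(R)$), and $R^\bullet=R\setminus \mathsf Z(R)$ the set of regular elements, which is a monoid under multiplication. For a subring $R\subseteq D$, $\mathsf T(R)=\mathsf T(D)$ means that regular elements of $R$ are regular in $D$ and the induced inclusion $\mathsf T(R)\subseteq\mathsf T(D)$ is an equality. $RD^\times=\{ru \mid r\in R, u\in D^\times\}$. For subsets $X,Y\subseteq \mathsf T(R)$ let $(X:Y)=\{a\in \mathsf T(R)\mid aY\subseteq X\}$. For an $R$-submodule $I$ of $\mathsf T(R)$ let $I^{-1}=(R:I)$ and $I_v=(I^{-1})^{-1}$; $I$ is a $v$-ideal (divisorial) if $I=I_v$. $v\text{-}\max(R)$ is the set of maximal $v$-ideals of $R$, i.e. the maximal elements, with respect to inclusion, among the $v$-ideals $I\subsetneq R$ (not required to be regular). Monoids are commutative, cancellative semigroups with identity; $H^\times$ is the unit group of a monoid $H$; $a\simeq b$ means $a=ub$ for some $u\in H^\times$. A monoid homomorphism $\theta:H\to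 B$ is a transfer homomorphism if (T1) $B=\theta(H)B^\times$ and $\theta^{-1}(B^\times)=H^\times$; and (T2) whenever $u\in H$, $b,c\in B$ and $\theta(u)=bc$, there exist $v,w\in H$ with $u=vw$, $\theta(v)\simeq b$ and $\theta(w)\simeq c$. An atom of $H$ is a non-unit $a$ such that $a=uv$ with $u,v\in H$ implies $u\in H^\times$ or $v\in H^\times$. $H$ is atomic if every non-unit is a finite product of atoms. $\mathsf L_H(a)=\{k\in\mathbb N\mid a \text{ is a product of } k \text{ atoms of } H\}$ for a non-unit $a$, and $\mathsf L_H(a)=\{0\}$ for $a\in H^\times$. A ring $R$ is atomic if $R^\bullet$ is an atomic monoid, and $\mathcal L(R)=\{\mathsf L_{R^\bullet}(a)\mid a\in R^\bullet\}$. *)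

theory Defs
  imports "HOL-Algebra.Subrings" "HOL-Algebra.Divisibility"
begin

section \<open>Regular elements\<close>

definition zero_divisors :: "('a, 'm) ring_scheme \<Rightarrow> 'a set" where
  "zero_divisors A =
     {a \<in> carrier A. \<exists>b \<in> carrier A. b \<noteq> \<zero>\<^bsub>A\<^esub> \<and> a \<otimes>\<^bsub>A\<^esub> b = \<zero>\<^bsub>A\<^esub>}"

definition regulars :: "('a, 'm) ring_scheme \<Rightarrow> 'a set" where
  "regulars A = carrier A - zero_divisors A"

definition regular_monoid :: "('a, 'm) ring_scheme \<Rightarrow> 'a monoid" where
  "regular_monoid A = \<lparr>carrier = regulars A, monoid.mult = (\<otimes>\<^bsub>A\<^esub>), one = one A\<rparr>"


section \<open>The total quotient ring\<close>

text \<open>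
  Since denominators are regular, a/s = b/t can be expressed by a t = b s without a further factor.
\<close>

definition tq_rel :: "('a, 'm) ring_scheme \<Rightarrow> (('a \<times> 'a) \<times> ('a \<times> 'a)) set" where
  "tq_rel A = {((a, s), (b, t)). a \<in> carrier A \<and> s \<in> regulars A \<and> b \<in> carrier A \<and> t \<in> regulars A
                  \<and> a \<otimes>\<^bsub>A\<^esub> t = b \<otimes>\<^bsub>A\<^esub> s}"

definition tq_frac :: "('a, 'm) ring_scheme \<Rightarrow> 'a \<Rightarrow> 'a \<Rightarrow> ('a \<times> 'a) set" where
  "tq_frac A a s = tq_rel A `` {(a, s)}"

definition total_quotient_ring :: "('a, 'm) ring_scheme \<Rightarrow> ('a \<times> 'a) set ring" where
  "total_quotient_ring A =
     \<lparr>carrier = (carrier A \<times> regulars A) // tq_rel A,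
      monoid.mult = (\<lambda>x y. \<Union>p \<in> x. \<Union>q \<in> y. tq_frac A (fst p \<otimes>\<^bsub>A\<^esub> fst q) (snd p \<otimes>\<^bsub>A\<^esub> snd q)),
      one = tq_frac A \<one>\<^bsub>A\<^esub> \<one>\<^bsub>A\<^esub>,
      zero = tq_frac A \<zero>\<^bsub>A\<^esub> \<one>\<^bsub>A\<^esub>,
      add = (\<lambda>x y. \<Union>p \<in> x. \<Union>q \<in> y.
               tq_frac A ((fst p \<otimes>\<^bsub>A\<^esub> snd q) \<oplus>\<^bsub>A\<^esub> (fst q \<otimes>\<^bsub>A\<^esub> snd p)) (snd p \<otimes>\<^bsub>A\<^esub> snd q))\<rparr>"

definition tq_embed :: "('a, 'm) ring_scheme \<Rightarrow> 'a \<Rightarrow> ('a \<times> 'a) set" where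
  "tq_embed A a = tq_frac A a \<one>\<^bsub>A\<^esub>"

definition tq_image :: "('a, 'm) ring_scheme \<Rightarrow> ('a \<times> 'a) set set" where
  "tq_image A = tq_embed A ` carrier A"

context cring
begin

lemma regularsI:
  "a \<in> carrier R \<Longrightarrow> (\<And>b. b \<in> carrier R \<Longrightarrow> a \<otimes> b = \<zero> \<Longrightarrow> b = \<zero>) \<Longrightarrow> a \<in> regulars R"
  unfolding regulars_def zero_divisors_def by blast

lemma regulars_closed [simp]: "a \<in> regulars R \<Longrightarrow> a \<in> carrier R"
  unfolding regulars_def by blast

lemma regularsD: "a \<in> regulars R \<Longrightarrow> b \<in> carrier R \<Longrightarrow> a \<otimes> b = \<zero> \<Longrightarrow> b = \<zero>"
  unfolding regulars_def zero_divisors_def by blast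

lemma regulars_mult [simp]:
  assumes "a \<in> regulars R" "b \<in> regulars R"
  shows "a \<otimes> b \<in> regulars R"
proof (rule regularsI)
  fix c assume c: "c \<in> carrier R" "a \<otimes> b \<otimes> c = \<zero>"
  then have "a \<otimes> (b \<otimes> c) = \<zero>"
    using assms by (simp add: m_assoc)
  then show "c = \<zero>"
    using assms c by (meson m_closed regularsD regulars_closed)
qed (use assms in simp)

lemma regulars_one [simp]: "\<one> \<in> regulars R"
  by (rule regularsI) simp_all

lemma regulars_cancel:
  assumes "s \<in> regulars R" "a \<in> carrier R" "b \<in> carrier R" "s \<otimes> a = s \<otimes> b"
  shows "a = b"
proof -
  have "s \<otimes> (a \<ominus> b) = \<zero>"
    using assms by (simp add: a_minus_def r_distr r_minus r_neg)
  then have "a \<ominus> b = \<zero>"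
    using assms regularsD by blast
  then show ?thesis
    using assms by (simp add: r_right_minus_eq)
qed

lemma comm_monoid_cancel_regular_monoid: "comm_monoid_cancel (regular_monoid R)"
proof (rule comm_monoid_cancelI)
  show "comm_monoid (regular_monoid R)"
    by (rule comm_monoidI) (simp_all add: regular_monoid_def m_ac)
next
  fix a b c
  assume "a \<otimes>\<^bsub>regular_monoid R\<^esub> c = b \<otimes>\<^bsub>regular_monoid R\<^esub> c"
    "a \<in> carrier (regular_monoid R)" "b \<in> carrier (regular_monoid R)"
    "c \<in> carrier (regular_monoid R)"
  then show "a = b"
    using regulars_cancel[of c a b] by (simp add: regular_monoid_def m_comm)
qed

lemma equiv_tq_rel: "equiv (carrier R \<times> regulars R) (tq_rel R)"
proof (rule equivI)
  show "tq_rel R \<subseteq> (carrier R \<times> regulars R) \<times> carrier R \<times> regulars R"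
    unfolding tq_rel_def by auto
  show "refl_on (carrier R \<times> regulars R) (tq_rel R)"
    unfolding tq_rel_def refl_on_def by auto
  show "sym (tq_rel R)"
    unfolding tq_rel_def sym_def by auto
  show "trans (tq_rel R)"
  proof (rule transI, clarify)
    fix a s b t c u
    assume "((a, s), (b, t)) \<in> tq_rel R" "((b, t), (c, u)) \<in> tq_rel R"
    then have car: "a \<in> carrier R" "s \<in> regulars R" "b \<in> carrier R" "t \<in> regulars R"
        "c \<in> carrier R" "u \<in> regulars R"
      and eq: "a \<otimes> t = b \<otimes> s" "b \<otimes> u = c \<otimes> t"
      unfolding tq_rel_def by auto
    have "t \<otimes> (a \<otimes> u) = (a \<otimes> t) \<otimes> u"
      using car by (simp add: m_ac)
    also have "\<dots> = (b \<otimes> u) \<otimes> s"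
      using car eq(1) by (simp add: m_ac)
    also have "\<dots> = t \<otimes> (c \<otimes> s)"
      using car eq(2) by (simp add: m_ac)
    finally have "a \<otimes> u = c \<otimes> s"
      using car regulars_cancel by (meson m_closed regulars_closed)
    then show "((a, s), (c, u)) \<in> tq_rel R"
      unfolding tq_rel_def using car by auto
  qed
qed

lemma frac_eq_iff:
  assumes "a \<in> carrier R" "s \<in> regulars R" "b \<in> carrier R" "t \<in> regulars R"
  shows "tq_frac R a s = tq_frac R b t \<longleftrightarrow> a \<otimes> t = b \<otimes> s"
  using assms unfolding tq_frac_def
  by (subst eq_equiv_class_iff[OF equiv_tq_rel]) (auto simp: tq_rel_def)

lemma carrier_total_quotient_ring:
  "carrier (total_quotient_ring R) = {tq_frac R a s |a s. a \<in> carrier R \<and> s \<in> regulars R}"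
  unfolding total_quotient_ring_def tq_frac_def quotient_def by auto

lemma frac_closed [simp]:
  "a \<in> carrier R \<Longrightarrow> s \<in> regulars R \<Longrightarrow> tq_frac R a s \<in> carrier (total_quotient_ring R)"
  unfolding carrier_total_quotient_ring by blast

lemma UN_frac2:
  assumes "a \<in> carrier R" "s \<in> regulars R" "b \<in> carrier R" "t \<in> regulars R"
    and "\<And>a s a' s' b t b' t'. ((a, s), (a', s')) \<in> tq_rel R \<Longrightarrow> ((b, t), (b', t')) \<in> tq_rel R \<Longrightarrow>
           f (a, s) (b, t) = f (a', s') (b', t')"
  shows "(\<Union>x \<in> tq_frac R a s. \<Union>y \<in> tq_frac R b t. f x y) = f (a, s) (b, t)"
  unfolding tq_frac_def using assms
  by (intro UN_equiv_class2[OF equiv_tq_rel equiv_tq_rel])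
    (auto intro!: congruent2I')

lemma frac_mult:
  assumes "a \<in> carrier R" "s \<in> regulars R" "b \<in> carrier R" "t \<in> regulars R"
  shows "tq_frac R a s \<otimes>\<^bsub>total_quotient_ring R\<^esub> tq_frac R b t = tq_frac R (a \<otimes> b) (s \<otimes> t)"
proof -
  let ?f = "\<lambda>(a, s) (b, t). tq_frac R (a \<otimes> b) (s \<otimes> t)"
  have "(\<Union>x \<in> tq_frac R a s. \<Union>y \<in> tq_frac R b t. ?f x y) = ?f (a, s) (b, t)"
  proof (rule UN_frac2[OF assms])
    fix a s a' s' b t b' t'
    assume "((a, s), (a', s')) \<in> tq_rel R" "((b, t), (b', t')) \<in> tq_rel R"
    then have car: "a \<in> carrier R" "s \<in> regulars R" "b \<in> carrier R" "t \<in> regulars R"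
        "a' \<in> carrier R" "s' \<in> regulars R" "b' \<in> carrier R" "t' \<in> regulars R"
      and eq: "a \<otimes> s' = a' \<otimes> s" "b \<otimes> t' = b' \<otimes> t"
      unfolding tq_rel_def by auto
    have "(a \<otimes> b) \<otimes> (s' \<otimes> t') = (a \<otimes> s') \<otimes> (b \<otimes> t')"
      using car by (simp add: m_ac)
    also have "\<dots> = (a' \<otimes> s) \<otimes> (b' \<otimes> t)"
      by (simp only: eq)
    also have "\<dots> = (a' \<otimes> b') \<otimes> (s \<otimes> t)"
      using car by (simp add: m_ac)
    finally show "?f (a, s) (b, t) = ?f (a', s') (b', t')"
      using car by (simp add: frac_eq_iff)
  qed
  then show ?thesis
    by (simp add: total_quotient_ring_def case_prod_beta)
qed

lemma frac_add:
  assumes "a \<in> carrier R" "s \<in> regulars R" "b \<in> carrier R" "t \<in> regulars R"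
  shows "tq_frac R a s \<oplus>\<^bsub>total_quotient_ring R\<^esub> tq_frac R b t = tq_frac R (a \<otimes> t \<oplus> b \<otimes> s) (s \<otimes> t)"
proof -
  let ?f = "\<lambda>(a, s) (b, t). tq_frac R (a \<otimes> t \<oplus> b \<otimes> s) (s \<otimes> t)"
  have "(\<Union>x \<in> tq_frac R a s. \<Union>y \<in> tq_frac R b t. ?f x y) = ?f (a, s) (b, t)"
  proof (rule UN_frac2[OF assms])
    fix a s a' s' b t b' t'
    assume "((a, s), (a', s')) \<in> tq_rel R" "((b, t), (b', t')) \<in> tq_rel R"
    then have car: "a \<in> carrier R" "s \<in> regulars R" "b \<in> carrier R" "t \<in> regulars R"
        "a' \<in> carrier R" "s' \<in> regulars R" "b' \<in> carrier R" "t' \<in> regulars R"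
      and eq: "a \<otimes> s' = a' \<otimes> s" "b \<otimes> t' = b' \<otimes> t"
      unfolding tq_rel_def by auto
    have car': "a \<in> carrier R" "s \<in> carrier R" "b \<in> carrier R" "t \<in> carrier R"
        "a' \<in> carrier R" "s' \<in> carrier R" "b' \<in> carrier R" "t' \<in> carrier R"
      using car by simp_all
    have "(a \<otimes> t \<oplus> b \<otimes> s) \<otimes> (s' \<otimes> t') = (a \<otimes> s') \<otimes> (t \<otimes> t') \<oplus> (b \<otimes> t') \<otimes> (s \<otimes> s')"
      using car' by algebra
    also have "\<dots> = (a' \<otimes> s) \<otimes> (t \<otimes> t') \<oplus> (b' \<otimes> t) \<otimes> (s \<otimes> s')"
      by (simp only: eq)
    also have "\<dots> = (a' \<otimes> t' \<oplus> b' \<otimes> s') \<otimes> (s \<otimes> t)"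
      using car' by algebra
    finally show "?f (a, s) (b, t) = ?f (a', s') (b', t')"
      using car by (simp add: frac_eq_iff)
  qed
  then show ?thesis
    by (simp add: total_quotient_ring_def case_prod_beta)
qed

lemma one_tq: "\<one>\<^bsub>total_quotient_ring R\<^esub> = tq_frac R \<one> \<one>"
  and zero_tq: "\<zero>\<^bsub>total_quotient_ring R\<^esub> = tq_frac R \<zero> \<one>"
  by (simp_all add: total_quotient_ring_def)

lemma frac_cases:
  assumes "x \<in> carrier (total_quotient_ring R)"
  obtains a s where "a \<in> carrier R" "s \<in> regulars R" "x = tq_frac R a s"
  using assms unfolding carrier_total_quotient_ring by blast

lemma cring_total_quotient_ring: "cring (total_quotient_ring R)"
proof (rule cringI)
  let ?T = "total_quotient_ring R"
  show "abelian_group ?T"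
  proof (rule abelian_groupI)
    fix x y z assume "x \<in> carrier ?T" "y \<in> carrier ?T" "z \<in> carrier ?T"
    then obtain a s b t c u where *: "a \<in> carrier R" "s \<in> regulars R" "x = tq_frac R a s"
        "b \<in> carrier R" "t \<in> regulars R" "y = tq_frac R b t"
        "c \<in> carrier R" "u \<in> regulars R" "z = tq_frac R c u"
      by (elim frac_cases)
    have car: "s \<in> carrier R" "t \<in> carrier R" "u \<in> carrier R"
      using * by simp_all
    have "((a \<otimes> t \<oplus> b \<otimes> s) \<otimes> u \<oplus> c \<otimes> (s \<otimes> t)) \<otimes> (s \<otimes> (t \<otimes> u)) =
        (a \<otimes> (t \<otimes> u) \<oplus> (b \<otimes> u \<oplus> c \<otimes> t) \<otimes> s) \<otimes> (s \<otimes> t \<otimes> u)"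
      using *(1,4,7) car by algebra
    then show "x \<oplus>\<^bsub>?T\<^esub> y \<oplus>\<^bsub>?T\<^esub> z = x \<oplus>\<^bsub>?T\<^esub> (y \<oplus>\<^bsub>?T\<^esub> z)"
      using * by (simp add: frac_add frac_eq_iff)
  next
    fix x assume "x \<in> carrier ?T"
    then obtain a s where x: "a \<in> carrier R" "s \<in> regulars R" "x = tq_frac R a s"
      by (rule frac_cases)
    then have "tq_frac R (\<ominus> a) s \<oplus>\<^bsub>?T\<^esub> x = \<zero>\<^bsub>?T\<^esub>"
      by (simp add: frac_add zero_tq frac_eq_iff l_minus l_neg)
    then show "\<exists>y \<in> carrier ?T. y \<oplus>\<^bsub>?T\<^esub> x = \<zero>\<^bsub>?T\<^esub>"
      using x by (metis a_inv_closed frac_closed)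
  next
    show "\<zero>\<^bsub>?T\<^esub> \<in> carrier ?T"
      by (simp add: zero_tq)
  next
    fix x y assume "x \<in> carrier ?T" "y \<in> carrier ?T"
    then obtain a s b t where *: "a \<in> carrier R" "s \<in> regulars R" "x = tq_frac R a s"
        "b \<in> carrier R" "t \<in> regulars R" "y = tq_frac R b t"
      by (elim frac_cases)
    then show "x \<oplus>\<^bsub>?T\<^esub> y \<in> carrier ?T"
      by (simp add: frac_add)
    show "x \<oplus>\<^bsub>?T\<^esub> y = y \<oplus>\<^bsub>?T\<^esub> x"
      using * by (simp add: frac_add a_comm m_comm[of s t])
  next
    fix x assume "x \<in> carrier ?T"
    then show "\<zero>\<^bsub>?T\<^esub> \<oplus>\<^bsub>?T\<^esub> x = x"
      by (elim frac_cases) (simp add: frac_add zero_tq)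
  qed
  show "comm_monoid ?T"
  proof (rule comm_monoidI)
    fix x y z assume "x \<in> carrier ?T" "y \<in> carrier ?T" "z \<in> carrier ?T"
    then show "x \<otimes>\<^bsub>?T\<^esub> y \<otimes>\<^bsub>?T\<^esub> z = x \<otimes>\<^bsub>?T\<^esub> (y \<otimes>\<^bsub>?T\<^esub> z)"
      by (elim frac_cases) (simp add: frac_mult m_assoc)
  next
    fix x y assume "x \<in> carrier ?T" "y \<in> carrier ?T"
    then obtain a s b t where *: "a \<in> carrier R" "s \<in> regulars R" "x = tq_frac R a s"
        "b \<in> carrier R" "t \<in> regulars R" "y = tq_frac R b t"
      by (elim frac_cases)
    then show "x \<otimes>\<^bsub>?T\<^esub> y \<in> carrier ?T"
      by (simp add: frac_mult)
    show "x \<otimes>\<^bsub>?T\<^esub> y = y \<otimes>\<^bsub>?T\<^esub> x"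
      using * by (simp add: frac_mult m_comm[of a b] m_comm[of s t])
  next
    fix x assume "x \<in> carrier ?T"
    then show "\<one>\<^bsub>?T\<^esub> \<otimes>\<^bsub>?T\<^esub> x = x"
      by (elim frac_cases) (simp add: frac_mult one_tq)
  qed (simp add: one_tq)
  fix x y z assume "x \<in> carrier ?T" "y \<in> carrier ?T" "z \<in> carrier ?T"
  then obtain a s b t c u where *: "a \<in> carrier R" "s \<in> regulars R" "x = tq_frac R a s"
      "b \<in> carrier R" "t \<in> regulars R" "y = tq_frac R b t"
      "c \<in> carrier R" "u \<in> regulars R" "z = tq_frac R c u"
    by (elim frac_cases)
  have car: "s \<in> carrier R" "t \<in> carrier R" "u \<in> carrier R"
    using * by simp_all
  have "((a \<otimes> t \<oplus> b \<otimes> s) \<otimes> c) \<otimes> ((s \<otimes> u) \<otimes> (t \<otimes> u)) =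
      ((a \<otimes> c) \<otimes> (t \<otimes> u) \<oplus> (b \<otimes> c) \<otimes> (s \<otimes> u)) \<otimes> (s \<otimes> t \<otimes> u)"
    using *(1,4,7) car by algebra
  then show "(x \<oplus>\<^bsub>?T\<^esub> y) \<otimes>\<^bsub>?T\<^esub> z = x \<otimes>\<^bsub>?T\<^esub> z \<oplus>\<^bsub>?T\<^esub> y \<otimes>\<^bsub>?T\<^esub> z"
    using * by (simp add: frac_add frac_mult frac_eq_iff)
qed

lemma tq_embed_hom: "tq_embed R \<in> ring_hom R (total_quotient_ring R)"
  by (rule ring_hom_memI) (simp_all add: tq_embed_def frac_mult frac_add one_tq)

lemma inj_on_tq_embed: "inj_on (tq_embed R) (carrier R)"
  by (rule inj_onI) (simp add: tq_embed_def frac_eq_iff)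

lemma tq_embed_regular_Unit:
  assumes "s \<in> regulars R"
  shows "tq_embed R s \<in> Units (total_quotient_ring R)"
proof -
  let ?T = "total_quotient_ring R"
  interpret T: cring ?T
    by (rule cring_total_quotient_ring)
  have "tq_frac R \<one> s \<otimes>\<^bsub>?T\<^esub> tq_embed R s = \<one>\<^bsub>?T\<^esub>"
    using assms by (simp add: tq_embed_def frac_mult one_tq frac_eq_iff)
  moreover have "tq_frac R \<one> s \<in> carrier ?T" "tq_embed R s \<in> carrier ?T"
    using assms by (simp_all add: tq_embed_def)
  ultimately show ?thesis
    unfolding Units_def using T.m_comm by fastforce
qed

end


section \<open>Total quotient rings of subrings\<close>

text \<open>
  A subring \<open>S\<close> of \<open>D\<close> is regarded as a ring of its own by restricting the carrier of \<open>D\<close>.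
  \<open>tq_incl S D\<close> maps the fraction r/s over \<open>S\<close> to the fraction r/s over \<open>D\<close>; it is well defined
  and injective as soon as regular elements of \<open>S\<close> are regular in \<open>D\<close>.
\<close>

definition tq_incl :: "'a set \<Rightarrow> ('a, 'm) ring_scheme \<Rightarrow> ('a \<times> 'a) set \<Rightarrow> ('a \<times> 'a) set" where
  "tq_incl S D x = (\<Union>p \<in> x. tq_frac D (fst p) (snd p))"

definition same_total_quotient_ring :: "'a set \<Rightarrow> ('a, 'm) ring_scheme \<Rightarrow> bool" where
  "same_total_quotient_ring S D \<longleftrightarrow>
     regulars (D\<lparr>carrier := S\<rparr>) \<subseteq> regulars D \<and>
     tq_incl S D ` carrier (total_quotient_ring (D\<lparr>carrier := S\<rparr>)) = carrier (total_quotient_ring D)"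

lemma tq_incl_frac:
  assumes D: "cring D" and S: "subring S D"
    and reg: "regulars (D\<lparr>carrier := S\<rparr>) \<subseteq> regulars D"
    and r: "r \<in> S" and s: "s \<in> regulars (D\<lparr>carrier := S\<rparr>)"
  shows "tq_incl S D (tq_frac (D\<lparr>carrier := S\<rparr>) r s) = tq_frac D r s"
proof -
  interpret cring D by fact
  have sub: "S \<subseteq> carrier D"
    using S by (rule subringE(1))
  have *: "tq_frac D r' s' = tq_frac D r s" if "(r', s') \<in> tq_frac (D\<lparr>carrier := S\<rparr>) r s" for r' s'
    using that reg sub r s by (subst frac_eq_iff) (auto simp: tq_frac_def tq_rel_def)
  have "(r, s) \<in> tq_frac (D\<lparr>carrier := S\<rparr>) r s"
    using r s by (simp add: tq_frac_def tq_rel_def)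
  moreover have "tq_frac D (fst p) (snd p) = tq_frac D r s"
    if "p \<in> tq_frac (D\<lparr>carrier := S\<rparr>) r s" for p
    using *[of "fst p" "snd p"] that by simp
  ultimately show ?thesis
    unfolding tq_incl_def by (intro UN_constant_eq ballI)
qed

lemma inj_on_tq_incl:
  assumes D: "cring D" and S: "subring S D"
    and reg: "regulars (D\<lparr>carrier := S\<rparr>) \<subseteq> regulars D"
  shows "inj_on (tq_incl S D) (carrier (total_quotient_ring (D\<lparr>carrier := S\<rparr>)))"
proof -
  interpret D: cring D by fact
  interpret S: cring "D\<lparr>carrier := S\<rparr>"
    using D.subcring_iff D.subcringI'[OF S] D.ring_axioms subringE(1)[OF S] by blast
  have sub: "S \<subseteq> carrier D"
    using S by (rule subringE(1))
  show ?thesis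
  proof (rule inj_onI)
    fix x y
    assume "x \<in> carrier (total_quotient_ring (D\<lparr>carrier := S\<rparr>))"
      "y \<in> carrier (total_quotient_ring (D\<lparr>carrier := S\<rparr>))" "tq_incl S D x = tq_incl S D y"
    then obtain a s b t where *: "a \<in> S" "s \<in> regulars (D\<lparr>carrier := S\<rparr>)" "x = tq_frac (D\<lparr>carrier := S\<rparr>) a s"
      "b \<in> S" "t \<in> regulars (D\<lparr>carrier := S\<rparr>)" "y = tq_frac (D\<lparr>carrier := S\<rparr>) b t"
      "tq_frac D a s = tq_frac D b t"
      by (elim S.frac_cases) (auto simp: tq_incl_frac[OF D S reg])
    then have "a \<otimes>\<^bsub>D\<^esub> t = b \<otimes>\<^bsub>D\<^esub> s"
      using D.frac_eq_iff reg sub by (meson subsetD)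
    then show "x = y"
      using * S.frac_eq_iff[of a s b t] by simp
  qed
qed


section \<open>Divisorial ideals\<close>

definition colon ::
    "('a, 'm) ring_scheme \<Rightarrow> ('a \<times> 'a) set set \<Rightarrow> ('a \<times> 'a) set set \<Rightarrow> ('a \<times> 'a) set set" where
  "colon A I J = {x \<in> carrier (total_quotient_ring A).
                    \<forall>y \<in> J. x \<otimes>\<^bsub>total_quotient_ring A\<^esub> y \<in> I}"

definition inv_ideal :: "('a, 'm) ring_scheme \<Rightarrow> ('a \<times> 'a) set set \<Rightarrow> ('a \<times> 'a) set set" where
  "inv_ideal A I = colon A (tq_image A) I"

definition v_closure :: "('a, 'm) ring_scheme \<Rightarrow> ('a \<times> 'a) set set \<Rightarrow> ('a \<times> 'a) set set" where
  "v_closure A I = inv_ideal A (inv_ideal A I)"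

definition tq_submodule :: "('a, 'm) ring_scheme \<Rightarrow> ('a \<times> 'a) set set \<Rightarrow> bool" where
  "tq_submodule A I \<longleftrightarrow>
     additive_subgroup I (total_quotient_ring A) \<and>
     (\<forall>a \<in> carrier A. \<forall>x \<in> I. tq_embed A a \<otimes>\<^bsub>total_quotient_ring A\<^esub> x \<in> I)"

definition v_ideal :: "('a, 'm) ring_scheme \<Rightarrow> ('a \<times> 'a) set set \<Rightarrow> bool" where
  "v_ideal A I \<longleftrightarrow> tq_submodule A I \<and> I = v_closure A I"

definition v_max :: "('a, 'm) ring_scheme \<Rightarrow> ('a \<times> 'a) set set set" where
  "v_max A = {I. v_ideal A I \<and> I \<subset> tq_image A \<and>
                 (\<forall>J. v_ideal A J \<and> J \<subset> tq_image A \<and> I \<subseteq> J \<longrightarrow> J = I)}"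

text \<open>
  (S : D) as a subset of the total quotient ring of \<open>S\<close>. There, \<open>D\<close> consists of the elements
  which \<open>tq_incl\<close> identifies with elements of \<open>D\<close>; this recovers all of \<open>D\<close> when
  \<open>same_total_quotient_ring S D\<close>.
\<close>

definition conductor :: "'a set \<Rightarrow> ('a, 'm) ring_scheme \<Rightarrow> ('a \<times> 'a) set set" where
  "conductor S D = colon (D\<lparr>carrier := S\<rparr>) (tq_image (D\<lparr>carrier := S\<rparr>))
     {x \<in> carrier (total_quotient_ring (D\<lparr>carrier := S\<rparr>)). tq_incl S D x \<in> tq_image D}"


section \<open>Transfer homomorphisms and sets of lengths\<close>

definition unit_assoc :: "('a, 'm) monoid_scheme \<Rightarrow> 'a \<Rightarrow> 'a \<Rightarrow> bool" where
  "unit_assoc H a b \<longleftrightarrow> (\<exists>u \<in> Units H. a = u \<otimes>\<^bsub>H\<^esub> b)"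

definition transfer_hom ::
    "('a, 'm) monoid_scheme \<Rightarrow> ('b, 'n) monoid_scheme \<Rightarrow> ('a \<Rightarrow> 'b) \<Rightarrow> bool" where
  "transfer_hom H B \<theta> \<longleftrightarrow>
     comm_monoid_cancel H \<and> comm_monoid_cancel B \<and>
     \<theta> \<in> hom H B \<and> \<theta> \<one>\<^bsub>H\<^esub> = \<one>\<^bsub>B\<^esub> \<and>
     carrier B = (\<theta> ` carrier H) <#>\<^bsub>B\<^esub> Units B \<and>
     {u \<in> carrier H. \<theta> u \<in> Units B} = Units H \<and>
     (\<forall>u \<in> carrier H. \<forall>b \<in> carrier B. \<forall>c \<in> carrier B. \<theta> u = b \<otimes>\<^bsub>B\<^esub> c \<longrightarrow>
        (\<exists>v \<in> carrier H. \<exists>w \<in> carrier H.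
           u = v \<otimes>\<^bsub>H\<^esub> w \<and> unit_assoc B (\<theta> v) b \<and> unit_assoc B (\<theta> w) c))"

text \<open>
  The library's \<open>irreducible\<close> is phrased through proper factors, and \<open>ring_irreducible\<close> concerns
  the multiplicative monoid of all elements of a ring.
\<close>

definition monoid_atoms :: "('a, 'm) monoid_scheme \<Rightarrow> 'a set" where
  "monoid_atoms H = {a \<in> carrier H. a \<notin> Units H \<and>
     (\<forall>u \<in> carrier H. \<forall>v \<in> carrier H. a = u \<otimes>\<^bsub>H\<^esub> v \<longrightarrow> u \<in> Units H \<or> v \<in> Units H)}"

definition atom_product :: "('a, 'm) monoid_scheme \<Rightarrow> 'a list \<Rightarrow> 'a \<Rightarrow> bool" where
  "atom_product H as a \<longleftrightarrow> set as \<subseteq> monoid_atoms H \<and> foldr (\<otimes>\<^bsub>H\<^esub>) as \<one>\<^bsub>H\<^esub> = a"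

definition atomic_monoid :: "('a, 'm) monoid_scheme \<Rightarrow> bool" where
  "atomic_monoid H \<longleftrightarrow> (\<forall>a \<in> carrier H - Units H. \<exists>as. atom_product H as a)"

definition length_set :: "('a, 'm) monoid_scheme \<Rightarrow> 'a \<Rightarrow> nat set" where
  "length_set H a = (if a \<in> Units H then {0} else {length as |as. atom_product H as a})"

definition atomic_ring :: "('a, 'm) ring_scheme \<Rightarrow> bool" where
  "atomic_ring A \<longleftrightarrow> atomic_monoid (regular_monoid A)"

definition length_sets :: "('a, 'm) ring_scheme \<Rightarrow> nat set set" where
  "length_sets A = length_set (regular_monoid A) ` regulars A"

end

theory Submission
  imports Defs
begin

text \<open>
  Let \<open>P\<close> be the set of \<open>x \<in> R\<close> with \<open>x D \<subseteq> R\<close>, i.e. the conductor seen inside \<open>R\<close>. If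
  \<open>x \<in> R - P\<close>, the v-ideal generated by \<open>P\<close> and \<open>x\<close> is \<open>R\<close> by maximality, so any \<open>t\<close> with
  \<open>t P \<subseteq> R\<close> and \<open>t x \<in> R\<close> lies in \<open>R\<close>. As \<open>P D \<subseteq> R\<close>, this says that \<open>d \<in> D\<close> and \<open>d x \<in> R\<close>
  imply \<open>d \<in> R\<close>. In particular \<open>r s \<in> P\<close> forces \<open>r \<in> P\<close> or \<open>s \<in> P\<close>.

  Given a factorization of \<open>u \<in> R\<close> in \<open>D\<close>, write it as \<open>u = r s g\<close> with \<open>r, s \<in> R\<close> and \<open>g\<close> a unit
  of \<open>D\<close>. If \<open>r \<in> P\<close> then \<open>u = (r g) s\<close> is a factorization in \<open>R\<close>, if \<open>s \<in> P\<close> then so is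
  \<open>u = r (s g)\<close>, and otherwise \<open>r s \<notin> P\<close>, so that \<open>g \<in> R\<close>.
\<close>

section \<open>Transfer homomorphisms preserve sets of lengths\<close>

text \<open>Units have length set {0} by convention, so only factorizations of non-units are lifted.
  The restriction matters: the empty list is a factorization of \<open>1\<close> but of no other
  unit, so lifting would fail for units that are merely associated.\<close>

lemma length_set_subsetI:
  assumes "a \<in> Units G \<longleftrightarrow> b \<in> Units H"
    and lift: "\<And>as. atom_product G as a \<Longrightarrow> a \<notin> Units G \<Longrightarrow>
      \<exists>bs. atom_product H bs b \<and> length bs = length as"
  shows "length_set G a \<subseteq> length_set H b"
proof (cases "a \<in> Units G")
  case True
  with assms(1) show ?thesis
    unfolding length_set_def by simp
next
  case False
  show ?thesis
  proof
    fix n assume "n \<in> length_set G a"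
    then obtain as where as: "atom_product G as a" "n = length as"
      using False unfolding length_set_def by auto
    obtain bs where "atom_product H bs b" "length bs = n"
      using lift[OF as(1) False] as(2) by blast
    then show "n \<in> length_set H b"
      using False assms(1) unfolding length_set_def by auto
  qed
qed

section \<open>Units, associates and atoms in a cancellative monoid\<close>

context comm_monoid_cancel
begin

lemma Units_factors:
  assumes "a \<in> carrier G" "b \<in> carrier G" "a \<otimes> b \<in> Units G"
  shows "a \<in> Units G" "b \<in> Units G"
  using assms unit_factor m_comm by metis+

lemma unit_assoc_Units_iff:
  assumes "unit_assoc G a b" "b \<in> carrier G"
  shows "a \<in> Units G \<longleftrightarrow> b \<in> Units G"
  using assms Units_factors(2) Units_closed Units_m_closed unfolding unit_assoc_def by metis

lemma unit_assoc_sym: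
  assumes "unit_assoc G a b" "b \<in> carrier G"
  shows "unit_assoc G b a"
proof -
  obtain u where u: "u \<in> Units G" "a = u \<otimes> b"
    using assms unfolding unit_assoc_def by blast
  then have "b = inv u \<otimes> a"
    using assms(2) by (simp add: Units_closed m_assoc[symmetric])
  then show ?thesis
    using u unfolding unit_assoc_def by blast
qed

lemma monoid_atoms_mult_unit:
  assumes a: "a \<in> monoid_atoms G" and u: "u \<in> Units G"
  shows "u \<otimes> a \<in> monoid_atoms G"
proof -
  have car: "a \<in> carrier G" "u \<in> carrier G" and nu: "a \<notin> Units G"
    using a u by (auto simp: monoid_atoms_def)
  have "u \<otimes> a \<notin> Units G"
    using Units_factors(2) car nu by blast
  moreover have "b \<in> Units G \<or> c \<in> Units G"
    if "b \<in> carrier G" "c \<in> carrier G" "u \<otimes> a = b \<otimes> c" for b c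
  proof -
    have "a = inv u \<otimes> (u \<otimes> a)"
      using u car by (simp add: m_assoc[symmetric])
    also have "\<dots> = (inv u \<otimes> b) \<otimes> c"
      using that u by (simp add: m_assoc)
    finally have "inv u \<otimes> b \<in> Units G \<or> c \<in> Units G"
      using a that u unfolding monoid_atoms_def by auto
    then show ?thesis
      using Units_factors(2) that u by blast
  qed
  ultimately show ?thesis
    using car unfolding monoid_atoms_def by blast
qed

lemma foldr_mult_closed: "set as \<subseteq> carrier G \<Longrightarrow> foldr (\<otimes>) as \<one> \<in> carrier G"
  by (induction as) auto

text \<open>The unit is absorbed into the first atom of the list. There is a first atom because the
  empty list would make \<open>a\<close> equal to \<open>1\<close>.\<close>

lemma atom_product_mult_unit:
  assumes "atom_product G as a" "u \<in> Units G" "a \<notin> Units G"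
  obtains bs where "atom_product G bs (u \<otimes> a)" "length bs = length as"
proof (cases as)
  case Nil
  then show ?thesis
    using assms by (auto simp: atom_product_def)
next
  case (Cons b cs)
  have atoms: "b \<in> monoid_atoms G" "set cs \<subseteq> monoid_atoms G"
    and a: "a = b \<otimes> foldr (\<otimes>) cs \<one>"
    using assms(1) Cons by (auto simp: atom_product_def)
  have "b \<in> carrier G" "set cs \<subseteq> carrier G"
    using atoms unfolding monoid_atoms_def by blast+
  then have "(u \<otimes> b) \<otimes> foldr (\<otimes>) cs \<one> = u \<otimes> a"
    using assms(2) a by (simp add: m_assoc foldr_mult_closed Units_closed)
  then have "atom_product G ((u \<otimes> b) # cs) (u \<otimes> a)"
    using atoms monoid_atoms_mult_unit[OF _ assms(2)] by (simp add: atom_product_def)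
  then show ?thesis
    using that Cons by simp
qed

lemma length_set_unit_assoc:
  assumes "unit_assoc G a b" "b \<in> carrier G"
  shows "length_set G a = length_set G b"
proof -
  \<comment> \<open>Association is symmetric, so one inclusion for all associated pairs gives the
    equality.\<close>
  have le: "length_set G a \<subseteq> length_set G b"
    if ab: "unit_assoc G a b" "b \<in> carrier G" for a b
  proof -
    obtain u where u: "u \<in> Units G" "b = u \<otimes> a"
      using unit_assoc_sym[OF ab] unfolding unit_assoc_def by blast
    show ?thesis
    proof (rule length_set_subsetI)
      show "a \<in> Units G \<longleftrightarrow> b \<in> Units G"
        by (rule unit_assoc_Units_iff[OF ab])
      show "\<exists>bs. atom_product G bs b \<and> length bs = length as"
        if "atom_product G as a" "a \<notin> Units G" for as
        unfolding u(2) by (rule atom_product_mult_unit[OF that(1) u(1) that(2)]) blast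
    qed
  qed
  have "a \<in> carrier G"
    using assms unfolding unit_assoc_def by auto
  with le[OF assms] le[OF unit_assoc_sym[OF assms]] show ?thesis
    by blast
qed

end

section \<open>Atoms and factorizations along a transfer homomorphism\<close>

locale transfer_homomorphism =
  H: comm_monoid_cancel H + B: comm_monoid_cancel B
  for H :: "('a, 'm) monoid_scheme" (structure)
    and B :: "('b, 'n) monoid_scheme" and \<theta> :: "'a \<Rightarrow> 'b" +
  assumes transfer: "transfer_hom H B \<theta>"
begin

lemma closed: "a \<in> carrier H \<Longrightarrow> \<theta> a \<in> carrier B"
  using transfer unfolding transfer_hom_def hom_def by blast

lemma mult: "a \<in> carrier H \<Longrightarrow> b \<in> carrier H \<Longrightarrow> \<theta> (a \<otimes> b) = \<theta> a \<otimes>\<^bsub>B\<^esub> \<theta> b"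
  using transfer unfolding transfer_hom_def hom_def by blast

lemma one: "\<theta> \<one> = \<one>\<^bsub>B\<^esub>"
  using transfer unfolding transfer_hom_def by blast

lemma Units_iff: "a \<in> carrier H \<Longrightarrow> \<theta> a \<in> Units B \<longleftrightarrow> a \<in> Units H"
  using transfer unfolding transfer_hom_def by blast

lemma lift:
  assumes "u \<in> carrier H" "b \<in> carrier B" "c \<in> carrier B" "\<theta> u = b \<otimes>\<^bsub>B\<^esub> c"
  obtains v w where "v \<in> carrier H" "w \<in> carrier H" "u = v \<otimes> w"
    "unit_assoc B (\<theta> v) b" "unit_assoc B (\<theta> w) c"
  using transfer assms unfolding transfer_hom_def by blast

lemma surj_assoc:
  assumes "b \<in> carrier B"
  obtains a where "a \<in> carrier H" "unit_assoc B b (\<theta> a)"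
proof -
  have "carrier B = (\<theta> ` carrier H) <#>\<^bsub>B\<^esub> Units B"
    using transfer unfolding transfer_hom_def by blast
  with assms obtain a e where "a \<in> carrier H" "e \<in> Units B" "b = \<theta> a \<otimes>\<^bsub>B\<^esub> e"
    unfolding set_mult_def by blast
  moreover from this have "b = e \<otimes>\<^bsub>B\<^esub> \<theta> a"
    using closed B.m_comm B.Units_closed by simp
  ultimately show ?thesis
    using that unfolding unit_assoc_def by blast
qed

text \<open>A factorization of \<open>u\<close> maps to one of \<open>\<theta> u\<close>, and by
  (T2) a factorization of \<open>\<theta> u\<close> lifts to one of \<open>u\<close> up to units of
  \<open>B\<close>. Both passages respect which factors are units.\<close>

lemma atoms_iff:
  assumes u: "u \<in> carrier H"
  shows "\<theta> u \<in> monoid_atoms B \<longleftrightarrow> u \<in> monoid_atoms H"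
proof
  assume a: "\<theta> u \<in> monoid_atoms B"
  have "v \<in> Units H \<or> w \<in> Units H"
    if vw: "v \<in> carrier H" "w \<in> carrier H" "u = v \<otimes> w" for v w
  proof -
    have "\<theta> u = \<theta> v \<otimes>\<^bsub>B\<^esub> \<theta> w"
      using vw mult by blast
    then have "\<theta> v \<in> Units B \<or> \<theta> w \<in> Units B"
      using a closed[OF vw(1)] closed[OF vw(2)] unfolding monoid_atoms_def by blast
    then show ?thesis
      using Units_iff vw by blast
  qed
  moreover have "u \<notin> Units H"
    using a Units_iff[OF u] unfolding monoid_atoms_def by blast
  ultimately show "u \<in> monoid_atoms H"
    using u unfolding monoid_atoms_def by blast
next
  assume a: "u \<in> monoid_atoms H"
  have "b \<in> Units B \<or> c \<in> Units B"
    if bc: "b \<in> carrier B" "c \<in> carrier B" "\<theta> u = b \<otimes>\<^bsub>B\<^esub> c" for b c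
  proof -
    obtain v w where vw: "v \<in> carrier H" "w \<in> carrier H" "u = v \<otimes> w"
      "unit_assoc B (\<theta> v) b" "unit_assoc B (\<theta> w) c"
      using lift[OF u bc] .
    then have "v \<in> Units H \<or> w \<in> Units H"
      using a unfolding monoid_atoms_def by blast
    then show ?thesis
      using B.unit_assoc_Units_iff[OF vw(4) bc(1)] B.unit_assoc_Units_iff[OF vw(5) bc(2)]
        Units_iff[OF vw(1)] Units_iff[OF vw(2)] by blast
  qed
  moreover have "\<theta> u \<notin> Units B"
    using a Units_iff[OF u] unfolding monoid_atoms_def by blast
  ultimately show "\<theta> u \<in> monoid_atoms B"
    using closed[OF u] unfolding monoid_atoms_def by blast
qed

lemma atom_product_image:
  assumes "atom_product H as a"
  shows "atom_product B (map \<theta> as) (\<theta> a)"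
proof -
  have "foldr (\<otimes>\<^bsub>B\<^esub>) (map \<theta> as) \<one>\<^bsub>B\<^esub> = \<theta> (foldr (\<otimes>) as \<one>)" if "set as \<subseteq> carrier H"
    using that by (induction as) (simp_all add: one mult H.foldr_mult_closed)
  moreover have "set as \<subseteq> carrier H"
    using assms unfolding atom_product_def monoid_atoms_def by blast
  moreover from this have "\<theta> x \<in> monoid_atoms B" if "x \<in> set as" for x
    using that assms atoms_iff[of x] unfolding atom_product_def by blast
  ultimately show ?thesis
    using assms unfolding atom_product_def by (simp add: image_subset_iff)
qed

text \<open>Induction on the list: (T2) splits off a lift of the first atom. The remaining factor
  maps only to an associate of the remaining product, which is why the statement asks for
  association instead of equality.\<close>

lemma atom_product_lift:
  assumes "atom_product B bs b" "unit_assoc B (\<theta> a) b" "a \<in> carrier H" "a \<notin> Units H"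
  shows "\<exists>as. atom_product H as a \<and> length as = length bs"
  using assms
proof (induction bs arbitrary: a b)
  case Nil
  then have "unit_assoc B (\<theta> a) \<one>\<^bsub>B\<^esub>"
    by (simp add: atom_product_def)
  then have "\<theta> a \<in> Units B"
    using B.unit_assoc_Units_iff[OF _ B.one_closed] by simp
  with Nil show ?case
    using Units_iff by blast
next
  case (Cons c cs)
  define d where "d = foldr (\<otimes>\<^bsub>B\<^esub>) cs \<one>\<^bsub>B\<^esub>"
  have c: "c \<in> carrier B" "c \<in> monoid_atoms B" and cs: "atom_product B cs d"
    and b: "b = c \<otimes>\<^bsub>B\<^esub> d"
    using Cons.prems(1) by (auto simp: atom_product_def monoid_atoms_def d_def)
  have "set cs \<subseteq> carrier B"
    using cs unfolding atom_product_def monoid_atoms_def by blast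
  then have d: "d \<in> carrier B"
    unfolding d_def by (rule B.foldr_mult_closed)
  obtain e where e: "e \<in> Units B" "\<theta> a = e \<otimes>\<^bsub>B\<^esub> b"
    using Cons.prems unfolding unit_assoc_def by blast
  \<comment> \<open>(T2) speaks about an exact factorization of \<open>\<theta> a\<close>, so the
    unit \<open>e\<close> is moved into the first atom.\<close>
  have ec: "e \<otimes>\<^bsub>B\<^esub> c \<in> carrier B" and eq: "\<theta> a = (e \<otimes>\<^bsub>B\<^esub> c) \<otimes>\<^bsub>B\<^esub> d"
    using e b c d B.Units_closed by (simp_all add: B.m_assoc)
  obtain v w where vw: "v \<in> carrier H" "w \<in> carrier H" "a = v \<otimes> w"
    "unit_assoc B (\<theta> v) (e \<otimes>\<^bsub>B\<^esub> c)" "unit_assoc B (\<theta> w) d"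
    using lift[OF Cons.prems(3) ec d eq] .
  have "\<theta> v \<in> monoid_atoms B"
  proof -
    obtain f where "f \<in> Units B" "\<theta> v = f \<otimes>\<^bsub>B\<^esub> (e \<otimes>\<^bsub>B\<^esub> c)"
      using vw(4) unfolding unit_assoc_def by blast
    then show ?thesis
      using B.monoid_atoms_mult_unit c(2) e(1) by simp
  qed
  then have v: "v \<in> monoid_atoms H"
    using atoms_iff vw by blast
  show ?case
  proof (cases "w \<in> Units H")
    \<comment> \<open>The induction hypothesis covers only non-units. Here \<open>d\<close> is a
      unit and a product of atoms, so \<open>cs\<close> is empty, and \<open>a\<close>, an associate
      of the atom \<open>v\<close>, is itself the one-element factorization.\<close>
    case True
    then have "d \<in> Units B"
      using B.unit_assoc_Units_iff[OF vw(5) d] Units_iff[OF vw(2)] by blast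
    then have "cs = []"
    proof (cases cs)
      case (Cons c' cs')
      then have c': "c' \<in> monoid_atoms B" and "set cs' \<subseteq> monoid_atoms B"
        and dc: "d = c' \<otimes>\<^bsub>B\<^esub> foldr (\<otimes>\<^bsub>B\<^esub>) cs' \<one>\<^bsub>B\<^esub>"
        using cs by (auto simp: atom_product_def)
      then have "set cs' \<subseteq> carrier B" "c' \<in> carrier B"
        unfolding monoid_atoms_def by blast+
      then have "c' \<in> Units B"
        using B.Units_factors(1) B.foldr_mult_closed \<open>d \<in> Units B\<close> unfolding dc by blast
      then show ?thesis
        using c' unfolding monoid_atoms_def by blast
    qed
    moreover have "a \<in> monoid_atoms H"
      using H.monoid_atoms_mult_unit[OF v True] vw(1-3) H.m_comm[of v w] by simp
    then have "atom_product H [a] a"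
      using Cons.prems(3) unfolding atom_product_def by simp
    then have "\<exists>as. atom_product H as a \<and> length as = 1"
      by (intro exI[of _ "[a]"]) simp
    ultimately show ?thesis
      by simp
  next
    case False
    then obtain as where "atom_product H as w" "length as = length cs"
      using Cons.IH[OF cs vw(5,2)] by blast
    then have "atom_product H (v # as) a" "length (v # as) = length (c # cs)"
      using v vw(3) unfolding atom_product_def by simp_all
    then show ?thesis
      by blast
  qed
qed

lemma length_set_image:
  assumes "a \<in> carrier H"
  shows "length_set B (\<theta> a) = length_set H a"
proof (rule equalityI; rule length_set_subsetI)
  show "\<theta> a \<in> Units B \<longleftrightarrow> a \<in> Units H" "a \<in> Units H \<longleftrightarrow> \<theta> a \<in> Units B"
    using Units_iff[OF assms] by simp_all
  have "unit_assoc B (\<theta> a) (\<theta> a)"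
    unfolding unit_assoc_def using closed[OF assms] B.Units_one_closed B.l_one by metis
  then show "\<exists>as. atom_product H as a \<and> length as = length bs"
    if "atom_product B bs (\<theta> a)" "\<theta> a \<notin> Units B" for bs
    using atom_product_lift[OF that(1) _ assms] that(2) Units_iff[OF assms] by simp
  show "\<exists>bs. atom_product B bs (\<theta> a) \<and> length bs = length as"
    if "atom_product H as a" for as
    using atom_product_image[OF that] length_map by blast
qed

text \<open>By (T1) every element of \<open>B\<close> is associated to some
  \<open>\<theta> a\<close>, and associated elements have equal length sets, so surjectivity up to
  units is enough.\<close>

lemma length_sets_eq: "length_set B ` carrier B = length_set H ` carrier H"
proof (intro equalityI subsetI)
  fix L assume "L \<in> length_set B ` carrier B"
  then obtain b where b: "b \<in> carrier B" "L = length_set B b"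
    by blast
  obtain a where "a \<in> carrier H" "unit_assoc B b (\<theta> a)"
    using surj_assoc[OF b(1)] .
  then have "L = length_set H a"
    using b(2) B.length_set_unit_assoc[OF _ closed] length_set_image by simp
  then show "L \<in> length_set H ` carrier H"
    using \<open>a \<in> carrier H\<close> by blast
next
  fix L assume "L \<in> length_set H ` carrier H"
  then show "L \<in> length_set B ` carrier B"
    using closed length_set_image by auto
qed

end


section \<open>Maximal divisorial ideals\<close>

context cring
begin

lemma Units_subset_regulars: "Units R \<subseteq> regulars R"
proof
  fix u assume u: "u \<in> Units R"
  show "u \<in> regulars R"
  proof (rule regularsI)
    fix b assume "b \<in> carrier R" "u \<otimes> b = \<zero>"
    then show "b = \<zero>"
      using u Units_l_cancel[OF u, of b \<zero>] by (simp add: Units_closed)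
  qed (use u in auto)
qed

lemma Units_regular_monoid: "Units (regular_monoid R) = Units R"
proof
  show "Units (regular_monoid R) \<subseteq> Units R"
    unfolding Units_def regular_monoid_def by auto
  show "Units R \<subseteq> Units (regular_monoid R)"
  proof
    fix u assume "u \<in> Units R"
    then have "u \<in> regulars R" "inv u \<in> regulars R" "inv u \<otimes> u = \<one>" "u \<otimes> inv u = \<one>"
      using Units_subset_regulars by auto
    then show "u \<in> Units (regular_monoid R)"
      unfolding Units_def regular_monoid_def by auto
  qed
qed

lemma frac_in_tq_image_iff:
  assumes "a \<in> carrier R" "s \<in> regulars R"
  shows "tq_frac R a s \<in> tq_image R \<longleftrightarrow> (\<exists>b \<in> carrier R. a = b \<otimes> s)"
proof -
  have "tq_frac R a s = tq_frac R b \<one> \<longleftrightarrow> a = b \<otimes> s" if "b \<in> carrier R" for b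
    using assms that by (subst frac_eq_iff) auto
  then show ?thesis
    unfolding tq_image_def tq_embed_def by auto
qed

lemma tq_image_subset: "tq_image R \<subseteq> carrier (total_quotient_ring R)"
  unfolding tq_image_def tq_embed_def by auto

lemma subring_tq_image: "subring (tq_image R) (total_quotient_ring R)"
proof -
  interpret T: cring "total_quotient_ring R"
    by (rule cring_total_quotient_ring)
  interpret h: ring_hom_ring R "total_quotient_ring R" "tq_embed R"
    by (rule ring_hom_ringI2[OF ring_axioms T.ring_axioms tq_embed_hom])
  show ?thesis
    unfolding tq_image_def by (rule h.img_is_subring[OF carrier_is_subring])
qed

section \<open>The inverse operation on subsets of the total quotient ring\<close>

lemma inv_ideal_subset: "inv_ideal R X \<subseteq> carrier (total_quotient_ring R)"
  unfolding inv_ideal_def colon_def by blast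

lemma inv_ideal_antimono: "X \<subseteq> Y \<Longrightarrow> inv_ideal R Y \<subseteq> inv_ideal R X"
  unfolding inv_ideal_def colon_def by blast

lemma subset_v_closure:
  assumes "X \<subseteq> carrier (total_quotient_ring R)"
  shows "X \<subseteq> v_closure R X"
proof -
  interpret T: cring "total_quotient_ring R"
    by (rule cring_total_quotient_ring)
  show ?thesis
    using assms T.m_comm unfolding v_closure_def inv_ideal_def colon_def by fastforce
qed

lemma tq_submodule_inv_ideal:
  assumes X: "X \<subseteq> carrier (total_quotient_ring R)"
  shows "tq_submodule R (inv_ideal R X)"
proof -
  let ?T = "total_quotient_ring R"
  interpret T: cring ?T
    by (rule cring_total_quotient_ring)
  have T: "y \<in> carrier ?T" if "y \<in> X" for y
    using X that by blast
  note img = subringE[OF subring_tq_image]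
  have "subgroup (inv_ideal R X) (add_monoid ?T)"
  proof (rule T.add.subgroupI)
    show "inv_ideal R X \<subseteq> carrier ?T"
      by (rule inv_ideal_subset)
    have "\<zero>\<^bsub>?T\<^esub> \<in> inv_ideal R X"
      using T img(2) by (simp add: inv_ideal_def colon_def)
    then show "inv_ideal R X \<noteq> {}"
      by blast
  next
    fix x assume x: "x \<in> inv_ideal R X"
    then show "\<ominus>\<^bsub>?T\<^esub> x \<in> inv_ideal R X"
      using T by (simp add: inv_ideal_def colon_def T.l_minus img(5))
    fix y assume "y \<in> inv_ideal R X"
    with x show "x \<oplus>\<^bsub>?T\<^esub> y \<in> inv_ideal R X"
      using T by (simp add: inv_ideal_def colon_def T.l_distr img(7))
  qed
  moreover have "tq_embed R a \<otimes>\<^bsub>?T\<^esub> x \<in> inv_ideal R X"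
    if "a \<in> carrier R" "x \<in> inv_ideal R X" for a x
  proof -
    have a: "tq_embed R a \<in> tq_image R"
      using that unfolding tq_image_def by blast
    then have "tq_embed R a \<in> carrier ?T"
      using tq_image_subset by blast
    then show ?thesis
      using that(2) T img(6)[OF a] by (simp add: inv_ideal_def colon_def T.m_assoc)
  qed
  ultimately show ?thesis
    unfolding tq_submodule_def additive_subgroup_def by blast
qed

text \<open>Taking inverses is an order-reversing Galois connection with itself, so three
  applications agree with one. \<open>X\<close> is an arbitrary subset of the total quotient
  ring.\<close>

lemma v_ideal_inv_ideal:
  assumes X: "X \<subseteq> carrier (total_quotient_ring R)"
  shows "v_ideal R (inv_ideal R X)"
proof -
  have "inv_ideal R X \<subseteq> v_closure R (inv_ideal R X)"
    by (rule subset_v_closure[OF inv_ideal_subset])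
  moreover have "v_closure R (inv_ideal R X) \<subseteq> inv_ideal R X"
    using inv_ideal_antimono[OF subset_v_closure[OF X]] unfolding v_closure_def .
  ultimately show ?thesis
    using tq_submodule_inv_ideal[OF X] unfolding v_ideal_def by blast
qed

text \<open>The v-closure of \<open>p\<close> together with \<open>z\<close> is a v-ideal inside the
  ring and strictly above \<open>p\<close>, hence by maximality the whole ring. It then contains
  \<open>1\<close>, so every element of the inverse, in particular \<open>t\<close>, lies in the
  ring.\<close>

lemma v_max_colon:
  assumes p: "p \<in> v_max R" and z: "z \<in> tq_image R" "z \<notin> p"
    and t: "t \<in> carrier (total_quotient_ring R)" "t \<otimes>\<^bsub>total_quotient_ring R\<^esub> z \<in> tq_image R"
      "\<And>y. y \<in> p \<Longrightarrow> t \<otimes>\<^bsub>total_quotient_ring R\<^esub> y \<in> tq_image R"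
  shows "t \<in> tq_image R"
proof -
  let ?T = "total_quotient_ring R"
  interpret T: cring ?T
    by (rule cring_total_quotient_ring)
  have max: "J = p" if "v_ideal R J" "J \<subset> tq_image R" "p \<subseteq> J" for J
    using p that unfolding v_max_def by blast
  \<comment> \<open>No submodule has to be generated first: the v-closure of any subset is a
    v-ideal.\<close>
  define X where "X = insert z p"
  have X: "X \<subseteq> tq_image R"
    using p z unfolding X_def v_max_def by blast
  then have XT: "X \<subseteq> carrier ?T"
    using tq_image_subset by blast
  have tX: "t \<in> inv_ideal R X"
    using t unfolding X_def inv_ideal_def colon_def by blast
  have one: "\<one>\<^bsub>?T\<^esub> \<in> tq_image R" "\<one>\<^bsub>?T\<^esub> \<in> inv_ideal R X"
    using subringE(3)[OF subring_tq_image] subsetD[OF X] subsetD[OF XT] by (simp_all add: inv_ideal_def colon_def)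
  \<comment> \<open>Since \<open>X\<close> lies in the ring, \<open>1\<close> belongs to its
    inverse, and testing against \<open>1\<close> keeps the v-closure inside the ring.\<close>
  have "v_closure R X \<subseteq> tq_image R"
  proof
    fix y assume "y \<in> v_closure R X"
    then have "y \<in> carrier ?T" "y \<otimes>\<^bsub>?T\<^esub> \<one>\<^bsub>?T\<^esub> \<in> tq_image R"
      using one(2) unfolding v_closure_def inv_ideal_def colon_def by blast+
    then show "y \<in> tq_image R"
      by simp
  qed
  moreover have "v_ideal R (v_closure R X)"
    unfolding v_closure_def by (rule v_ideal_inv_ideal[OF inv_ideal_subset])
  moreover have "p \<subseteq> v_closure R X" "v_closure R X \<noteq> p"
    using subset_v_closure[OF XT] z unfolding X_def by auto
  ultimately have "v_closure R X = tq_image R"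
    using max by blast
  then have "\<one>\<^bsub>?T\<^esub> \<in> inv_ideal R (inv_ideal R X)"
    using one(1) unfolding v_closure_def by simp
  then have "\<one>\<^bsub>?T\<^esub> \<otimes>\<^bsub>?T\<^esub> t \<in> tq_image R"
    using tX unfolding inv_ideal_def[of R "inv_ideal R X"] colon_def by blast
  then show ?thesis
    using t by simp
qed

end


section \<open>Extensions with maximal divisorial conductor\<close>

locale same_tq_extension = D: cring D for D :: "('a, 'm) ring_scheme" (structure) +
  fixes R :: "'a set"
  assumes subring: "subring R D" and same_tq: "same_total_quotient_ring R D"
begin

abbreviation S where "S \<equiv> D\<lparr>carrier := R\<rparr>"

lemma sub: "R \<subseteq> carrier D"
  using subring by (rule subringE(1))

sublocale S: cring S
  using D.subcring_iff D.subcringI'[OF subring] sub by blast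

lemma regulars_eq: "regulars S = regulars D \<inter> R"
proof
  show "regulars S \<subseteq> regulars D \<inter> R"
    using same_tq S.regulars_closed unfolding same_total_quotient_ring_def by auto
  show "regulars D \<inter> R \<subseteq> regulars S"
    using sub unfolding regulars_def zero_divisors_def by auto
qed

text \<open>This is the set \<open>P\<close> of the overview, stated without fractions. Demanding
  \<open>x \<in> R\<close> loses nothing, as \<open>d = 1\<close> would force it.\<close>

definition cond :: "'a set" where
  "cond = {x \<in> R. \<forall>d \<in> carrier D. x \<otimes> d \<in> R}"

text \<open>Equality of the total quotient rings writes \<open>d\<close> as a fraction r/s over
  \<open>R\<close>; clearing the denominator gives \<open>d \<otimes> s = r\<close>. From here on
  \<open>d\<close> is represented over \<open>R\<close> by the fraction (d s)/s.\<close>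

lemma denominator:
  assumes "d \<in> carrier D"
  obtains s where "s \<in> regulars S" "d \<otimes> s \<in> R"
proof -
  have "tq_frac D d \<one> \<in> tq_incl R D ` carrier (total_quotient_ring S)"
    using same_tq assms unfolding same_total_quotient_ring_def by simp
  then obtain r s where rs: "r \<in> R" "s \<in> regulars S" "tq_frac D d \<one> = tq_incl R D (tq_frac S r s)"
    by (auto elim!: S.frac_cases)
  then have "tq_frac D d \<one> = tq_frac D r s"
    using tq_incl_frac[OF D.cring_axioms subring] regulars_eq by auto
  moreover have "r \<in> carrier D" "s \<in> regulars D"
    using rs regulars_eq sub by auto
  ultimately have "d \<otimes> s = r"
    using assms by (simp add: D.frac_eq_iff)
  with rs that show ?thesis
    by blast
qed

lemma tq_incl_frac_in_image_iff:
  assumes "a \<in> R" "s \<in> regulars S"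
  shows "tq_incl R D (tq_frac S a s) \<in> tq_image D \<longleftrightarrow> (\<exists>d \<in> carrier D. a = d \<otimes> s)"
  using assms sub regulars_eq tq_incl_frac[OF D.cring_axioms subring]
  by (auto simp: D.frac_in_tq_image_iff subset_iff)

text \<open>The denominator \<open>s\<close> is regular in \<open>D\<close> as well, so it can be
  cancelled there and the fraction determines \<open>d\<close>.\<close>

lemma frac_in_tq_image:
  assumes "d \<in> carrier D" "s \<in> regulars S" "d \<otimes> s \<in> R"
  shows "tq_frac S (d \<otimes> s) s \<in> tq_image S \<longleftrightarrow> d \<in> R"
proof -
  have s: "s \<in> regulars D" "s \<in> carrier D"
    using assms regulars_eq by auto
  have "d = b" if "b \<in> R" "d \<otimes> s = b \<otimes> s" for b
    using D.regulars_cancel[OF s(1), of d b] that assms(1) s sub D.m_comm by auto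
  then show ?thesis
    using S.frac_in_tq_image_iff[of "d \<otimes> s" s] assms by auto
qed

text \<open>The elements of T(R) that the conductor is tested against are exactly the fractions (d
  s)/s with \<open>d\<close> in \<open>D\<close>, and multiplying by \<open>x\<close> gives (x d
  s)/s, which lies in \<open>R\<close> just when \<open>x \<otimes> d\<close> does.\<close>

lemma tq_embed_in_conductor_iff:
  assumes x: "x \<in> R"
  shows "tq_embed S x \<in> conductor R D \<longleftrightarrow> x \<in> cond"
proof
  assume "tq_embed S x \<in> conductor R D"
  then have *: "tq_frac S x \<one> \<otimes>\<^bsub>total_quotient_ring S\<^esub> y \<in> tq_image S"
    if "y \<in> carrier (total_quotient_ring S)" "tq_incl R D y \<in> tq_image D" for y
    using that unfolding conductor_def colon_def tq_embed_def by simp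
  have "x \<otimes> d \<in> R" if d: "d \<in> carrier D" for d
  proof -
    obtain s where s: "s \<in> regulars S" "d \<otimes> s \<in> R"
      using denominator[OF d] .
    have sD: "s \<in> carrier D" "s \<in> R"
      using s regulars_eq by auto
    have "tq_frac S (d \<otimes> s) s \<in> carrier (total_quotient_ring S)"
      using s S.frac_closed by simp
    moreover have "tq_incl R D (tq_frac S (d \<otimes> s) s) \<in> tq_image D"
      using tq_incl_frac_in_image_iff s d by blast
    ultimately have "tq_frac S x \<one> \<otimes>\<^bsub>total_quotient_ring S\<^esub> tq_frac S (d \<otimes> s) s \<in> tq_image S"
      by (rule *)
    then have "tq_frac S (x \<otimes> (d \<otimes> s)) s \<in> tq_image S"
      using S.frac_mult[of x \<one> "d \<otimes> s" s] x s sD S.regulars_one by simp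
    moreover have "x \<otimes> (d \<otimes> s) = (x \<otimes> d) \<otimes> s"
      using x sub d sD by (simp add: D.m_assoc subset_iff)
    moreover have "x \<otimes> (d \<otimes> s) \<in> R"
      using S.m_closed[of x "d \<otimes> s"] x s by simp
    ultimately show ?thesis
      using frac_in_tq_image[of "x \<otimes> d" s] s x sub d by (auto simp: subset_iff)
  qed
  then show "x \<in> cond"
    using x unfolding cond_def by blast
next
  assume xc: "x \<in> cond"
  have "tq_frac S x \<one> \<otimes>\<^bsub>total_quotient_ring S\<^esub> y \<in> tq_image S"
    if y: "y \<in> carrier (total_quotient_ring S)" "tq_incl R D y \<in> tq_image D" for y
  proof -
    obtain a s where as: "a \<in> R" "s \<in> regulars S" "y = tq_frac S a s"
      using y(1) by (rule S.frac_cases) simp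
    obtain d where d: "d \<in> carrier D" "a = d \<otimes> s"
      using y(2) tq_incl_frac_in_image_iff[OF as(1,2)] unfolding as(3) by blast
    have sD: "s \<in> carrier D" "s \<in> R"
      using as regulars_eq by auto
    have "x \<otimes> a = (x \<otimes> d) \<otimes> s"
      using x sub d sD by (simp add: D.m_assoc subset_iff)
    moreover have "x \<otimes> d \<in> R"
      using xc d unfolding cond_def by blast
    moreover have "x \<otimes> a \<in> R"
      using S.m_closed[of x a] x as by simp
    ultimately have "tq_frac S (x \<otimes> a) s \<in> tq_image S"
      using S.frac_in_tq_image_iff[of "x \<otimes> a" s] as by auto
    then show ?thesis
      using S.frac_mult[of x \<one> a s] x as sD S.regulars_one by simp
  qed
  moreover have "tq_frac S x \<one> \<in> carrier (total_quotient_ring S)"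
    using S.frac_closed[of x \<one>] x S.regulars_one by simp
  ultimately show "tq_embed S x \<in> conductor R D"
    unfolding conductor_def colon_def tq_embed_def by simp
qed

section \<open>Consequences of the maximality of the conductor\<close>

lemma mem_of_mult_mem:
  assumes max: "conductor R D \<in> v_max S"
    and x: "x \<in> R" "x \<notin> cond" and d: "d \<in> carrier D" "d \<otimes> x \<in> R"
  shows "d \<in> R"
proof -
  let ?T = "total_quotient_ring S"
  interpret T: cring ?T
    by (rule S.cring_total_quotient_ring)
  obtain s where s: "s \<in> regulars S" "d \<otimes> s \<in> R"
    using denominator[OF d(1)] .
  have sD: "s \<in> carrier D" "s \<in> R"
    using s regulars_eq by auto
  have t: "tq_frac S (d \<otimes> s) s \<in> carrier ?T" "tq_incl R D (tq_frac S (d \<otimes> s) s) \<in> tq_image D"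
    using s S.frac_closed tq_incl_frac_in_image_iff d by auto
  \<comment> \<open>Maximality is applied with the fraction representing \<open>d\<close> in the
    role of \<open>t\<close> and with \<open>x\<close> as the element outside the conductor.\<close>
  have "tq_frac S (d \<otimes> s) s \<in> tq_image S"
  proof (rule S.v_max_colon[OF max _ _ t(1)])
    show "tq_embed S x \<in> tq_image S"
      using x unfolding tq_image_def by simp
    show "tq_embed S x \<notin> conductor R D"
      using x tq_embed_in_conductor_iff by blast
    have "d \<otimes> s \<otimes> x = (d \<otimes> x) \<otimes> s"
      using x sub d sD by (simp add: D.m_ac subset_iff)
    moreover have "(d \<otimes> x) \<otimes> s \<in> R"
      using S.m_closed[of "d \<otimes> x" s] d sD by simp
    ultimately have "tq_frac S (d \<otimes> s \<otimes> x) s \<in> tq_image S"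
      using S.frac_in_tq_image_iff[of "d \<otimes> s \<otimes> x" s] s d by auto
    then show "tq_frac S (d \<otimes> s) s \<otimes>\<^bsub>?T\<^esub> tq_embed S x \<in> tq_image S"
      using S.frac_mult[of "d \<otimes> s" s x \<one>] x s sD S.regulars_one unfolding tq_embed_def by simp
    \<comment> \<open>By definition the conductor multiplies fractions representing elements of
      \<open>D\<close> into \<open>R\<close>, and \<open>t\<close> is one of them.\<close>
    fix y assume y: "y \<in> conductor R D"
    then have "y \<otimes>\<^bsub>?T\<^esub> tq_frac S (d \<otimes> s) s \<in> tq_image S" "y \<in> carrier ?T"
      using t unfolding conductor_def colon_def by simp_all
    then show "tq_frac S (d \<otimes> s) s \<otimes>\<^bsub>?T\<^esub> y \<in> tq_image S"
      using t(1) T.m_comm by metis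
  qed
  then show ?thesis
    using frac_in_tq_image d s by blast
qed

text \<open>If \<open>s\<close> is outside \<open>cond\<close>, then for each \<open>d\<close> in
  \<open>D\<close> the element \<open>r \<otimes> d\<close> of \<open>D\<close> is multiplied into
  \<open>R\<close> by \<open>s\<close>, hence lies in \<open>R\<close> already.\<close>

lemma cond_prime:
  assumes max: "conductor R D \<in> v_max S"
    and rs: "r \<in> R" "s \<in> R" "r \<otimes> s \<in> cond"
  shows "r \<in> cond \<or> s \<in> cond"
proof (rule disjCI)
  assume s: "s \<notin> cond"
  have "r \<otimes> d \<in> R" if d: "d \<in> carrier D" for d
  proof (rule mem_of_mult_mem[OF max rs(2) s])
    have "r \<otimes> d \<otimes> s = r \<otimes> s \<otimes> d"
      using rs sub d by (simp add: D.m_ac subset_iff)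
    then show "r \<otimes> d \<otimes> s \<in> R"
      using rs(3) d unfolding cond_def by simp
    show "r \<otimes> d \<in> carrier D"
      using rs sub d by auto
  qed
  then show "r \<in> cond"
    using rs unfolding cond_def by blast
qed

text \<open>A factor in \<open>cond\<close> absorbs any element of \<open>D\<close>. If neither
  factor is in \<open>cond\<close>, primality puts \<open>r \<otimes> s\<close> outside
  \<open>cond\<close>, and then \<open>g\<close> itself is in \<open>R\<close>.\<close>

lemma factorization:
  assumes max: "conductor R D \<in> v_max S"
    and rs: "r \<in> R" "s \<in> R" and g: "g \<in> Units D" "r \<otimes> s \<otimes> g \<in> R"
  shows "r \<otimes> g \<in> R \<or> s \<otimes> g \<in> R"
proof -
  have gD: "g \<in> carrier D"
    using g by blast
  consider "r \<in> cond" | "s \<in> cond" | "r \<otimes> s \<notin> cond"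
    using cond_prime[OF max rs] by blast
  then show ?thesis
  proof cases
    case 3
    have "r \<otimes> s \<in> R"
      using S.m_closed[of r s] rs by simp
    moreover have "g \<otimes> (r \<otimes> s) \<in> R"
      using g(2) gD rs sub by (simp add: D.m_comm subset_iff)
    ultimately have "g \<in> R"
      using mem_of_mult_mem[OF max _ 3 gD] by blast
    then show ?thesis
      using S.m_closed[of r g] rs by simp
  qed (use gD in \<open>auto simp: cond_def\<close>)
qed

section \<open>Verification of (T1) and (T2) for the inclusion\<close>

lemma transfer_hom_incl:
  assumes mult: "carrier D = R <#>\<^bsub>D\<^esub> Units D"
    and units: "Units D \<inter> R = Units S"
    and max: "conductor R D \<in> v_max S"
  shows "transfer_hom (regular_monoid S) (regular_monoid D) (\<lambda>x. x)"
proof -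
  \<comment> \<open>The factor \<open>r\<close> supplied by D = R D^x is regular, being
    \<open>b\<close> times a unit of \<open>D\<close>.\<close>
  have split: "\<exists>r e. r \<in> regulars S \<and> e \<in> Units D \<and> b = r \<otimes> e" if b: "b \<in> regulars D" for b
  proof -
    have "b \<in> R <#>\<^bsub>D\<^esub> Units D"
      using D.regulars_closed[OF b] mult by blast
    then obtain r e where re: "r \<in> R" "e \<in> Units D" "b = r \<otimes> e"
      unfolding set_mult_def by blast
    then have "r = b \<otimes> inv e"
      using sub by (simp add: D.m_assoc D.Units_closed subset_iff)
    then have "r \<in> regulars D"
      using b re D.Units_subset_regulars D.regulars_mult by blast
    then show ?thesis
      using re regulars_eq by blast
  qed
  have lift: "\<exists>v \<in> regulars S. \<exists>w \<in> regulars S. u = v \<otimes> w \<and>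
      (\<exists>h \<in> Units D. v = h \<otimes> b) \<and> (\<exists>h \<in> Units D. w = h \<otimes> c)"
    if u: "u \<in> regulars S" and b: "b \<in> regulars D" and c: "c \<in> regulars D" and eq: "u = b \<otimes> c"
    for u b c
  proof -
    obtain r e s f where re: "r \<in> regulars S" "e \<in> Units D" "b = r \<otimes> e"
      and sf: "s \<in> regulars S" "f \<in> Units D" "c = s \<otimes> f"
      using split[OF b] split[OF c] by blast
    \<comment> \<open>The units of both factors are collected, so that \<open>g\<close> as a whole
      can be attached to one of \<open>r\<close> and \<open>s\<close>.\<close>
    define g where "g = e \<otimes> f"
    have g: "g \<in> Units D" "g \<in> regulars D" "g \<in> carrier D"
      using re sf D.Units_subset_regulars unfolding g_def by auto
    have car: "r \<in> carrier D" "s \<in> carrier D" "r \<in> R" "s \<in> R" "r \<in> regulars D" "s \<in> regulars D"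
        "e \<in> carrier D" "f \<in> carrier D"
      using re sf regulars_eq by auto
    have ug: "u = r \<otimes> s \<otimes> g"
      using eq re sf car unfolding g_def by (simp add: D.m_ac)
    then have "r \<otimes> s \<otimes> g \<in> R"
      using u regulars_eq by blast
    then consider "r \<otimes> g \<in> R" | "s \<otimes> g \<in> R"
      using factorization[OF max] car g by blast
    then show ?thesis
    proof cases
      case 1
      have "inv e \<otimes> b = r" "inv f \<otimes> c = s"
        using re sf car by (simp_all add: D.m_lcomm)
      \<comment> \<open>Moving \<open>e\<close> and \<open>f\<close> to the first factor changes
        \<open>b\<close> by \<open>f\<close> and \<open>c\<close> by the inverse of
        \<open>f\<close>; these are the units witnessing association.\<close>
      then have "r \<otimes> g = f \<otimes> b" "s = inv f \<otimes> c"
        using re car unfolding g_def by (simp_all add: D.m_ac)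
      moreover have "r \<otimes> g \<in> regulars S"
        using 1 car g regulars_eq by auto
      moreover have "u = (r \<otimes> g) \<otimes> s"
        using ug car g by (simp add: D.m_ac)
      ultimately show ?thesis
        using re sf by (metis D.Units_inv_Units)
    next
      case 2
      \<comment> \<open>Symmetrically, the witnessing units are now the inverse of \<open>e\<close>
        and \<open>e\<close>.\<close>
      have "inv e \<otimes> b = r" "s \<otimes> g = e \<otimes> c"
        using re sf car unfolding g_def by (simp_all add: D.m_lcomm)
      moreover have "s \<otimes> g \<in> regulars S"
        using 2 car g regulars_eq by auto
      moreover have "u = r \<otimes> (s \<otimes> g)"
        using ug car g by (simp add: D.m_ac)
      ultimately show ?thesis
        using re sf by (metis D.Units_inv_Units)
    qed
  qed
  have surj: "regulars D = regulars S <#>\<^bsub>regular_monoid D\<^esub> Units D"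
  proof
    show "regulars D \<subseteq> regulars S <#>\<^bsub>regular_monoid D\<^esub> Units D"
      using split by (fastforce simp: set_mult_def regular_monoid_def)
    show "regulars S <#>\<^bsub>regular_monoid D\<^esub> Units D \<subseteq> regulars D"
      using regulars_eq D.Units_subset_regulars by (auto simp: set_mult_def regular_monoid_def)
  qed
  have monoid: "carrier (regular_monoid S) = regulars S" "carrier (regular_monoid D) = regulars D"
    "\<one>\<^bsub>regular_monoid S\<^esub> = \<one>" "\<one>\<^bsub>regular_monoid D\<^esub> = \<one>"
    "(\<otimes>\<^bsub>regular_monoid S\<^esub>) = (\<otimes>)" "(\<otimes>\<^bsub>regular_monoid D\<^esub>) = (\<otimes>)"
    by (simp_all add: regular_monoid_def)
  show ?thesis
    unfolding transfer_hom_def unit_assoc_def monoid D.Units_regular_monoid S.Units_regular_monoid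
  proof (intro conjI ballI impI)
    show "(\<lambda>x. x) \<in> hom (regular_monoid S) (regular_monoid D)"
      using regulars_eq by (auto simp: hom_def regular_monoid_def)
    \<comment> \<open>This is the hypothesis on units, restricted to regular elements; units of
      \<open>D\<close> are regular.\<close>
    show "{u \<in> regulars S. u \<in> Units D} = Units S"
      using units regulars_eq D.Units_subset_regulars by auto
    show "regulars D = (\<lambda>x. x) ` regulars S <#>\<^bsub>regular_monoid D\<^esub> Units D"
      using surj by simp
  qed (use lift S.comm_monoid_cancel_regular_monoid D.comm_monoid_cancel_regular_monoid in blast)+
qed

end

theorem theorem3p4:
  fixes D :: "('a, 'm) ring_scheme" and R :: "'a set"
  assumes "cring D" and "\<one>\<^bsub>D\<^esub> \<noteq> \<zero>\<^bsub>D\<^esub>"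
    and "subring R D"
    and "same_total_quotient_ring R D"
    and "carrier D = R <#>\<^bsub>D\<^esub> Units D"
    and "Units D \<inter> R = Units (D\<lparr>carrier := R\<rparr>)"
    and "conductor R D \<in> v_max (D\<lparr>carrier := R\<rparr>)"
  shows "transfer_hom (regular_monoid (D\<lparr>carrier := R\<rparr>)) (regular_monoid D) (\<lambda>x. x) \<and>
         (atomic_ring (D\<lparr>carrier := R\<rparr>) \<longrightarrow>
         length_sets (D\<lparr>carrier := R\<rparr>) = length_sets D)"
proof -
  interpret same_tq_extension D R
    using assms by (simp add: same_tq_extension_def same_tq_extension_axioms_def)
  have transfer: "transfer_hom (regular_monoid S) (regular_monoid D) (\<lambda>x. x)"
    using assms by (intro transfer_hom_incl)
  interpret transfer_homomorphism "regular_monoid S" "regular_monoid D" "\<lambda>x. x"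
    using transfer by (auto simp: transfer_homomorphism_def transfer_homomorphism_axioms_def
        transfer_hom_def)
  have "length_sets S = length_sets D"
    using length_sets_eq unfolding length_sets_def by (simp add: regular_monoid_def)
  then show ?thesis
    using transfer by blast
qed

end
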